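(* Let $G=(X,w,\boldsymbol 1)$ be a weighted connected graph with edge set $E$ and graph Laplacian $\Delta$, and let $\alpha\in(0,1)$. Let ${}_rG^\alpha=(X,{}_rw^\alpha,\boldsymbol 1)$ be the graph with edge weights, for $i\neq j$, $${}_rw^\alpha(x_i,x_j)=\begin{cases}-(\Delta^\alpha)_{i,j}&\text{if }\{x_i,x_j\}\notin E,\\ w(x_i,x_j)&\text{if }\{x_i,x_j\}\in E,\end{cases}$$ (and ${}_rw^\alpha(x_i,x_i)=0$). Then $\hat G\hookrightarrow_{\operatorname{id}}{}_r\hat G^\alpha$, where $\hat G$ and ${}_r\hat G^\alpha$ are the normalizations of $G$ and ${}_rG^\alpha$ and $\operatorname{id}:X\to X$ is the identity map; that is, ${}_rG^\alpha$ is compatible with $G$.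
   Context: **Graphs.** A graph is a triple $G=(X,w,\mu)$ where $X=\{x_i:i\in I\}$ is a finite node set with at least two nodes, $w:X\times X\to[0,\infty)$ is symmetric with $w(x,x)=0$ for all $x$, and $\mu:X\to(0,\infty)$. A pair $\{x,y\}$ is an edge (written $x\sim y$) iff $w(x,y)>0$; $E$ is the set of edges. All graphs are assumed connected. The degree is $\deg(x)=\sum_{y\in X}w(x,y)$. The measure $\mu$ is either the counting measure $\boldsymbol 1\equiv1$ or $\deg$. The normalization of $G$ is $\hat G=(X,w,\deg)$. The transition probabilities of $G$ are $p_{i,j}=w(x_i,x_j)/\deg(x_i)$. The graph Laplacian of $(X,w,\mu)$ is $\Delta[u](x)=\frac1{\mu(x)}\sum_{y\in X}w(x,y)(u(x)-u(y))$ for $u:X\to\mathbb R$. For $\mu=\boldsymbol 1$, $\Delta$ is a symmetric positive semidefinite matrix and $\Delta^\alpha=U\Lambda^\alpha U^T$ where $\Delta=U\Lambda U^T$ is a spectral decomposition; its off-diagonal entries are negative for $\alpha\in(0,1)$. **Embedding and compatibility via the identity.** Let $G=(X,w,\mu)$ and $G'=(X,w',\mu')$ be graphs on the same node set such that every edge of $G$ is an edge of $G'$. Let $\operatorname{id}(G)=(X,w_{\operatorname{id}},\mu_{\operatorname{id}})$, where $w_{\operatorname{id}}(x,y)=w'(x,y)$ if $\{x,y\}$ is an edge of $G$ and $0$ otherwise, and $\mu_{\operatorname{id}}=\boldsymbol 1$ if $\mu'=\boldsymbol 1$, while $\mu_{\operatorname{id}}(x)=\deg_{\operatorname{id}}(x):=\sum_{y}w_{\operatorname{id}}(x,y)$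 if $\mu'$ is the degree measure. $G\hookrightarrow_{\operatorname{id}}G'$ means that the graph Laplacians of $G$ and of $\operatorname{id}(G)$ coincide. $G'$ is compatible with $G$ if $G$ and $\operatorname{id}(G)$ have the same transition probabilities: $w(x,y)/\deg(x)=w_{\operatorname{id}}(x,y)/\deg_{\operatorname{id}}(x)$ for all $x,y\in X$. *)

theory Defs
  imports "HOL-Analysis.Analysis"
begin

(* The node set is a finite index type 'n (a node x_i is identified with its index i); the
   standing assumption of at least two nodes is part of is_graph below. *)

(* The node measure is either the counting measure or the degree measure.  Which of the two a
   graph carries is recorded by a tag instead of by the function mu itself: the two functions
   agree when every degree is 1, but induced graphs below depend on which one is meant. *)
datatype measure_kind = Counting | Degree

datatype 'n wgraph = WGraph (weight: "'n \<Rightarrow> 'n \<Rightarrow> real") (mkind: measure_kind)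

definition adj :: "'n wgraph \<Rightarrow> 'n \<Rightarrow> 'n \<Rightarrow> bool" where
  "adj G x y \<longleftrightarrow> weight G x y > 0"

definition wdeg :: "'n::finite wgraph \<Rightarrow> 'n \<Rightarrow> real" where
  "wdeg G x = (\<Sum>y\<in>UNIV. weight G x y)"

definition node_measure :: "'n::finite wgraph \<Rightarrow> 'n \<Rightarrow> real" where
  "node_measure G x = (case mkind G of Counting \<Rightarrow> 1 | Degree \<Rightarrow> wdeg G x)"

definition is_graph :: "'n::finite wgraph \<Rightarrow> bool" where
  "is_graph G \<longleftrightarrow>
     CARD('n) \<ge> 2 \<and>
     (\<forall>x y. weight G x y \<ge> 0) \<and>
     (\<forall>x y. weight G x y = weight G y x) \<and>
     (\<forall>x. weight G x x = 0) \<and>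
     (\<forall>x. node_measure G x > 0) \<and>
     (\<forall>x y. (adj G)\<^sup>*\<^sup>* x y)"

definition normalization :: "'n wgraph \<Rightarrow> 'n wgraph" where
  "normalization G = WGraph (weight G) Degree"

definition transition :: "'n::finite wgraph \<Rightarrow> 'n \<Rightarrow> 'n \<Rightarrow> real" where
  "transition G x y = weight G x y / wdeg G x"

definition laplacian :: "'n::finite wgraph \<Rightarrow> real^'n \<Rightarrow> real^'n" where
  "laplacian G u =
     (\<chi> x. 1 / node_measure G x * (\<Sum>y\<in>UNIV. weight G x y * (u $ x - u $ y)))"

definition diag_mat :: "real^'n \<Rightarrow> real^'n^'n" where
  "diag_mat d = (\<chi> i j. if i = j then d $ i else 0)"

(* Real power of a symmetric positive semidefinite matrix.  The result does not depend on the
   spectral decomposition, so the choice is only between equal matrices.  The entries of d are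
   the eigenvalues, hence nonnegative, and 0 powr \<alpha> = 0. *)
definition mat_powr :: "real^'n^'n \<Rightarrow> real \<Rightarrow> real^'n::finite^'n" where
  "mat_powr A \<alpha> = (SOME P. \<exists>U d. orthogonal_matrix U \<and>
     A = U ** diag_mat d ** transpose U \<and>
     P = U ** diag_mat (\<chi> i. d $ i powr \<alpha>) ** transpose U)"

definition r_graph :: "real \<Rightarrow> 'n::finite wgraph \<Rightarrow> 'n wgraph" where
  "r_graph \<alpha> G = WGraph
     (\<lambda>i j. if i = j then 0
            else if adj G i j then weight G i j
            else - (mat_powr (matrix (laplacian G)) \<alpha> $ i $ j))
     Counting"

(* The graph id(G): the edges of G, with weights and kind of measure taken from G'.  With
   kind Degree, its measure is the degree in id(G), not in G'. *)
definition id_graph :: "'n wgraph \<Rightarrow> 'n wgraph \<Rightarrow> 'n wgraph" where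
  "id_graph G G' = WGraph (\<lambda>x y. if adj G x y then weight G' x y else 0) (mkind G')"

(* The setting in which embedding and compatibility via the identity are defined; in
   particular both arguments have to be graphs. *)
definition id_setting :: "'n::finite wgraph \<Rightarrow> 'n wgraph \<Rightarrow> bool" where
  "id_setting G G' \<longleftrightarrow> is_graph G \<and> is_graph G' \<and> (\<forall>x y. adj G x y \<longrightarrow> adj G' x y)"

definition embeds_id :: "'n::finite wgraph \<Rightarrow> 'n wgraph \<Rightarrow> bool" where
  "embeds_id G G' \<longleftrightarrow> id_setting G G' \<and> laplacian G = laplacian (id_graph G G')"

definition compatible_with :: "'n::finite wgraph \<Rightarrow> 'n wgraph \<Rightarrow> bool" where
  "compatible_with G' G \<longleftrightarrow> id_setting G G' \<and>
     (\<forall>x y. transition G x y = transition (id_graph G G') x y)"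

end

theory Submission
  imports Defs
begin

text \<open>On the edges of \<open>G\<close> the weights of \<open>r_graph \<alpha> G\<close> are those of \<open>G\<close>, so the induced graphs are
  \<open>G\<close> and its normalization themselves. The content is that \<open>r_graph \<alpha> G\<close> is a graph at all, i.e.
  that the off-diagonal entries of the fractional Laplacian are nonpositive. They are limits of the
  entries of \<open>(\<Delta> + \<epsilon>I)\<close> to the power \<open>\<alpha>\<close> as \<open>\<epsilon>\<close> tends to \<open>0\<close>, and these are given by a convergent
  binomial series in powers of an entrywise nonnegative matrix.\<close>

section \<open>Spectral theorem for symmetric real matrices\<close>

text \<open>The polynomial has a minimum at \<open>t = 0\<close>, so its derivative there vanishes.
  This is the first-order condition at the maximiser below.\<close>

lemma linear_coeff_zero_if_nonneg:
  fixes a b :: real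
  assumes "\<And>t. 0 \<le> a * t + b * t\<^sup>2"
  shows "a = 0"
proof (rule ccontr)
  assume "a \<noteq> 0"
  \<comment> \<open>Any positive \<open>c\<close> above \<open>b\<close> works: at
    \<open>t = - a / c\<close> the polynomial takes the value
    \<open>a\<^sup>2 * (b - c) / c\<^sup>2\<close>, which is negative if \<open>a\<close> is
    nonzero.\<close>
  define c where "c = 1 + \<bar>b\<bar>"
  have c: "c > 0" "b < c" by (auto simp: c_def)
  have "0 \<le> (a * (- a / c) + b * (- a / c)\<^sup>2) * c\<^sup>2"
    using assms[of "- a / c"] by simp
  also have "\<dots> = a\<^sup>2 * (b - c)"
    using c by (simp add: power2_eq_square field_simps)
  finally show False
    using \<open>a \<noteq> 0\<close> c by (simp add: zero_le_mult_iff)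
qed

text \<open>A maximiser of the quadratic form on the unit sphere of the subspace is an eigenvector.\<close>

lemma self_adjoint_eigenvector:
  fixes f :: "'a::euclidean_space \<Rightarrow> 'a"
  assumes lin: "linear f" and sym: "\<And>x y. x \<bullet> f y = f x \<bullet> y"
    and S: "subspace S" "\<And>x. x \<in> S \<Longrightarrow> f x \<in> S" "a \<in> S" "a \<noteq> 0"
  obtains v c where "v \<in> S" "norm v = 1" "f v = c *\<^sub>R v"
proof -
  interpret f: linear f by (rule lin)
  have "compact (S \<inter> sphere 0 1)"
    using S(1) by (intro closed_Int_compact closed_subspace compact_sphere)
  moreover have "a /\<^sub>R norm a \<in> S \<inter> sphere 0 1"
    using S by (auto intro: subspace_scale)
  moreover have "continuous_on (S \<inter> sphere 0 1) (\<lambda>x. x \<bullet> f x)"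
    by (intro continuous_intros linear_continuous_on linear_conv_bounded_linear[THEN iffD1] lin)
  ultimately obtain v where v: "v \<in> S" "norm v = 1"
    and max: "\<And>x. x \<in> S \<Longrightarrow> norm x = 1 \<Longrightarrow> x \<bullet> f x \<le> v \<bullet> f v"
    using continuous_attains_sup[of "S \<inter> sphere 0 1" "\<lambda>x. x \<bullet> f x"] by fastforce
  define c where "c = v \<bullet> f v"
  have quad: "x \<bullet> f x \<le> c * (x \<bullet> x)" if "x \<in> S" for x
  proof (cases "x = 0")
    case False
    have "(x /\<^sub>R norm x) \<bullet> f (x /\<^sub>R norm x) \<le> c"
      unfolding c_def using False that S(1) by (intro max) (auto intro: subspace_scale)
    then show ?thesis
      using False by (simp add: f.scale dot_square_norm power2_eq_square field_simps)
  qed (simp add: f.zero)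
  \<comment> \<open>The form \<open>c * (x \<bullet> x) - x \<bullet> f x\<close> is nonnegative on
    \<open>S\<close> and zero at \<open>v\<close>. Perturbing \<open>v\<close> along the residual
    \<open>w\<close> itself gives it the linear coefficient \<open>2 * (w \<bullet> w)\<close>, so
    the residual must vanish.\<close>
  define w where "w = c *\<^sub>R v - f v"
  have "w \<in> S" unfolding w_def by (intro subspace_diff subspace_scale S v)
  have vv: "v \<bullet> v = 1" using v by (simp add: dot_square_norm)
  have "0 \<le> (2 * (w \<bullet> w)) * t + (c * (w \<bullet> w) - w \<bullet> f w) * t\<^sup>2" for t
  proof -
    let ?x = "v + t *\<^sub>R w"
    have "0 \<le> c * (?x \<bullet> ?x) - ?x \<bullet> f ?x"
      using quad[of ?x] S(1) v(1) \<open>w \<in> S\<close> by (simp add: subspace_add subspace_scale)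
    also have "\<dots> = c * (v \<bullet> v) - v \<bullet> f v + 2 * t * (c * (v \<bullet> w) - f v \<bullet> w)
        + (c * (w \<bullet> w) - w \<bullet> f w) * t\<^sup>2"
      using sym[of v w]
      by (simp add: f.add f.scale inner_add inner_commute power2_eq_square algebra_simps)
    also have "c * (v \<bullet> w) - f v \<bullet> w = w \<bullet> w"
      by (simp add: w_def inner_diff inner_commute algebra_simps)
    finally show ?thesis using vv by (simp add: c_def algebra_simps)
  qed
  then have "w = 0" using linear_coeff_zero_if_nonneg by fastforce
  then show ?thesis using v that[of v c] by (simp add: w_def)
qed

lemma orthonormal_card_le:
  fixes B :: "'a::euclidean_space set"
  assumes "pairwise orthogonal B" "\<And>b. b \<in> B \<Longrightarrow> norm b = 1"
  shows "independent B" "finite B" "card B \<le> DIM('a)"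
proof -
  have "0 \<notin> B" using assms(2) by force
  then show "independent B" using assms(1) by (rule pairwise_orthogonal_independent[rotated])
  then show "finite B" "card B \<le> DIM('a)" using independent_bound by auto
qed

text \<open>Take an orthonormal set of eigenvectors of largest cardinality. If it did not span, its
  orthogonal complement would be nonzero and, by self-adjointness, invariant, and would supply one
  more eigenvector.\<close>

lemma self_adjoint_orthonormal_eigenbasis:
  fixes f :: "'a::euclidean_space \<Rightarrow> 'a"
  assumes lin: "linear f" and sym: "\<And>x y. x \<bullet> f y = f x \<bullet> y"
  obtains B where "pairwise orthogonal B" "\<And>b. b \<in> B \<Longrightarrow> norm b = 1"
    "\<And>b. b \<in> B \<Longrightarrow> \<exists>c. f b = c *\<^sub>R b" "finite B" "card B = DIM('a)"
proof -
  interpret f: linear f by (rule lin)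
  define P where "P B \<longleftrightarrow> pairwise orthogonal B \<and> (\<forall>b\<in>B. norm b = 1 \<and> (\<exists>c. f b = c *\<^sub>R b))" for B
  have "P {}" by (simp add: P_def)
  moreover have "\<forall>B. P B \<longrightarrow> card B < Suc DIM('a)"
    using orthonormal_card_le(3) by (auto simp: P_def less_Suc_eq_le)
  ultimately obtain B where B: "P B" and max: "\<And>B'. P B' \<Longrightarrow> card B' \<le> card B"
    using ex_has_greatest_nat[of P "{}" card "Suc DIM('a)"] by blast
  have ind: "independent B" "finite B" using B orthonormal_card_le[of B] by (auto simp: P_def)
  have "span B = UNIV"
  proof (rule ccontr)
    assume "span B \<noteq> UNIV"
    then obtain a where a: "a \<noteq> 0" "\<forall>x\<in>span B. a \<bullet> x = 0"
      using span_not_UNIV_orthogonal by blast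
    define S where "S = {x. \<forall>b\<in>B. x \<bullet> b = 0}"
    have "subspace S" by (auto simp: S_def subspace_def inner_add)
    moreover have "f x \<in> S" if "x \<in> S" for x
      unfolding S_def
    proof safe
      fix b assume b: "b \<in> B"
      then obtain c where "f b = c *\<^sub>R b" using B by (auto simp: P_def)
      then show "f x \<bullet> b = 0" using that b sym[of x b] by (simp add: S_def)
    qed
    moreover have "a \<in> S" using a by (auto simp: S_def span_base)
    ultimately obtain v c where v: "v \<in> S" "norm v = 1" "f v = c *\<^sub>R v"
      using self_adjoint_eigenvector[OF lin sym, of S a] a(1) by blast
    have "P (insert v B)"
      using B v by (auto simp: P_def S_def pairwise_insert orthogonal_def inner_commute)
    moreover have "v \<notin> B" using v by (auto simp: S_def)
    ultimately show False using max[of "insert v B"] ind by simp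
  qed
  then have "card B = DIM('a)"
    using dim_span_eq_card_independent[OF ind(1)] by simp
  then show ?thesis using that[of B] B ind by (auto simp: P_def)
qed

lemma conj_diag_mat_nth:
  "(U ** diag_mat d ** transpose U) $ i $ j = (\<Sum>k\<in>UNIV. U $ i $ k * d $ k * U $ j $ k)"
  by (simp add: matrix_matrix_mult_def diag_mat_def transpose_def if_distrib[of "\<lambda>x. _ * x"]
      sum.delta cong: if_cong)

lemma symmetric_matrix_diagonalization:
  fixes A :: "real^'n^'n"
  assumes "transpose A = A"
  obtains U d where "orthogonal_matrix U" "A = U ** diag_mat d ** transpose U"
proof -
  have "x \<bullet> (A *v y) = (A *v x) \<bullet> y" for x y
    by (metis assms dot_lmul_matrix transpose_matrix_vector)
  then obtain B where B: "pairwise orthogonal B" "\<And>b. b \<in> B \<Longrightarrow> norm b = 1"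
    "\<And>b. b \<in> B \<Longrightarrow> \<exists>c. A *v b = c *\<^sub>R b" "finite B" "card B = CARD('n)"
    using self_adjoint_orthonormal_eigenbasis[of "(*v) A"] by auto
  \<comment> \<open>There are as many eigenvectors as coordinates, so the coordinate type itself can
    index them and they form the columns of a square matrix.\<close>
  then obtain h where h: "bij_betw h (UNIV :: 'n set) B"
    using finite_same_card_bij[of "UNIV :: 'n set" B] by auto
  have hB: "h k \<in> B" for k using h by (auto simp: bij_betw_def)
  have "\<forall>k. \<exists>c. A *v h k = c *\<^sub>R h k" using B(3)[OF hB] by blast
  then obtain e where e: "\<And>k. A *v h k = e k *\<^sub>R h k" unfolding choice_iff by blast
  have orth: "h k \<bullet> h l = (if k = l then 1 else 0)" for k l
  proof (cases "k = l")
    case True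
    then show ?thesis using B(2)[OF hB[of l]] by (simp add: dot_square_norm)
  next
    case False
    then have "h k \<noteq> h l" using h by (auto simp: bij_betw_def dest: injD)
    then have "orthogonal (h k) (h l)" using B(1) hB[of k] hB[of l] by (simp add: pairwise_def)
    then show ?thesis using False by (simp add: orthogonal_def)
  qed
  define U :: "real^'n^'n" where "U = (\<chi> i k. h k $ i)"
  have U: "orthogonal_matrix U"
    unfolding orthogonal_matrix vec_eq_iff
    using orth by (simp add: U_def matrix_matrix_mult_def transpose_def mat_def inner_vec_def)
  have "A ** U = U ** diag_mat (\<chi> k. e k)"
    using e by (simp add: U_def vec_eq_iff matrix_matrix_mult_def diag_mat_def matrix_vector_mult_def
        if_distrib[of "\<lambda>x. _ * x"] sum.delta mult.commute cong: if_cong)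
  then have "A ** (U ** transpose U) = U ** diag_mat (\<chi> k. e k) ** transpose U"
    by (simp add: matrix_mul_assoc)
  then show ?thesis using U that by (simp add: orthogonal_matrix_def)
qed

section \<open>Fractional matrix powers and the signs of their entries\<close>

lemma conj_diag_mat_mult:
  fixes U :: "real^'n^'n"
  assumes "orthogonal_matrix U"
  shows "(U ** diag_mat a ** transpose U) ** (U ** diag_mat b ** transpose U)
    = U ** diag_mat (\<chi> k. a $ k * b $ k) ** transpose U"
proof -
  have "(U ** diag_mat a ** transpose U) ** (U ** diag_mat b ** transpose U)
    = U ** (diag_mat a ** (transpose U ** U) ** diag_mat b) ** transpose U"
    by (simp add: matrix_mul_assoc)
  also have "transpose U ** U = mat 1" using assms by (simp add: orthogonal_matrix_def)
  also have "diag_mat a ** mat 1 ** diag_mat b = diag_mat (\<chi> k. a $ k * b $ k)"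
    unfolding matrix_mul_rid
    by (simp add: vec_eq_iff matrix_matrix_mult_def diag_mat_def
        if_distrib[of "\<lambda>x. x * _"] sum.delta cong: if_cong)
  finally show ?thesis .
qed

text \<open>By orthogonality of \<open>U\<close> the matrix is the \<open>n\<close>-th power of
  \<open>U ** diag_mat b ** transpose U\<close>, and products of entrywise nonnegative matrices are
  entrywise nonnegative.\<close>

lemma conj_diag_mat_power_nonneg:
  fixes U :: "real^'n^'n"
  assumes U: "orthogonal_matrix U"
    and nn: "\<And>i j. 0 \<le> (U ** diag_mat b ** transpose U) $ i $ j"
  shows "0 \<le> (U ** diag_mat (\<chi> k. b $ k ^ n) ** transpose U) $ i $ j"
proof (induction n arbitrary: i j)
  case 0
  have "diag_mat (\<chi> k. b $ k ^ 0) = (mat 1 :: real^'n^'n)"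
    by (simp add: diag_mat_def mat_def vec_eq_iff)
  then have "U ** diag_mat (\<chi> k. b $ k ^ 0) ** transpose U = mat 1"
    using U by (simp add: orthogonal_matrix_def)
  then show ?case by (simp add: mat_def)
next
  case (Suc n)
  have "U ** diag_mat (\<chi> k. b $ k ^ Suc n) ** transpose U
      = (U ** diag_mat b ** transpose U) ** (U ** diag_mat (\<chi> k. b $ k ^ n) ** transpose U)"
    using U by (simp add: conj_diag_mat_mult)
  then show ?case
    using Suc nn by (simp add: matrix_matrix_mult_def[of "U ** diag_mat b ** transpose U"] sum_nonneg)
qed

text \<open>These are the nonconstant coefficients of \<open>(1 - z) powr \<alpha>\<close>. Each
  arises from its predecessor by a nonnegative factor, so all inherit the sign of the first,
  \<open>- \<alpha>\<close>.\<close>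

lemma alternating_gbinomial_nonpos:
  fixes \<alpha> :: real
  assumes "0 < \<alpha>" "\<alpha> < 1"
  shows "(\<alpha> gchoose Suc n) * (- 1) ^ Suc n \<le> 0"
proof (induction n)
  case (Suc n)
  have "real (Suc (Suc n)) * (\<alpha> gchoose Suc (Suc n)) = (\<alpha> - real (Suc n)) * (\<alpha> gchoose Suc n)"
    using gbinomial_mult_1[of \<alpha> "Suc n"] by (simp add: algebra_simps)
  then have "(\<alpha> gchoose Suc (Suc n)) = (\<alpha> - real (Suc n)) * (\<alpha> gchoose Suc n) / real (Suc (Suc n))"
    by (simp add: eq_divide_eq mult.commute del: of_nat_Suc)
  then have "(\<alpha> gchoose Suc (Suc n)) * (- 1) ^ Suc (Suc n)
      = ((\<alpha> gchoose Suc n) * (- 1) ^ Suc n) * ((real (Suc n) - \<alpha>) / real (Suc (Suc n)))"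
    by (simp add: minus_divide_left algebra_simps del: of_nat_Suc)
  moreover have "0 \<le> (real (Suc n) - \<alpha>) / real (Suc (Suc n))"
    using assms by simp
  ultimately show ?case using Suc by (metis mult_nonpos_nonneg)
qed (use assms in simp)

text \<open>With \<open>s\<close> large, \<open>A + \<epsilon>I = s(I - B)\<close> where \<open>B\<close> is entrywise nonnegative with spectrum in
  \<open>[0,1)\<close>, and all coefficients of \<open>(1 - z) powr \<alpha>\<close> except the constant one are nonpositive.\<close>

lemma shifted_powr_offdiag_nonpos:
  fixes U A :: "real^'n^'n"
  assumes U: "orthogonal_matrix U" and A: "A = U ** diag_mat d ** transpose U"
    and d: "\<And>k. 0 \<le> d $ k" and off: "\<And>i j. i \<noteq> j \<Longrightarrow> A $ i $ j \<le> 0"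
    and \<alpha>: "0 < \<alpha>" "\<alpha> < 1" and \<epsilon>: "0 < \<epsilon>" and ij: "i \<noteq> j"
  shows "(\<Sum>k\<in>UNIV. U $ i $ k * (d $ k + \<epsilon>) powr \<alpha> * U $ j $ k) \<le> 0"
proof -
  \<comment> \<open>A crude common bound: dominating the shifted eigenvalues keeps the spectrum of
    \<open>?B\<close> nonnegative, dominating the shifted diagonal entries keeps the diagonal of
    \<open>?B\<close> nonnegative.\<close>
  define s where "s = (\<Sum>k\<in>UNIV. \<bar>d $ k\<bar> + \<bar>A $ k $ k\<bar>) + \<epsilon>"
  have s: "s > 0" "d $ k + \<epsilon> \<le> s" "A $ k $ k + \<epsilon> \<le> s" for k
  proof -
    have "\<bar>d $ k\<bar> + \<bar>A $ k $ k\<bar> \<le> (\<Sum>k\<in>UNIV. \<bar>d $ k\<bar> + \<bar>A $ k $ k\<bar>)"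
      by (intro member_le_sum) auto
    then show "s > 0" "d $ k + \<epsilon> \<le> s" "A $ k $ k + \<epsilon> \<le> s"
      unfolding s_def using \<epsilon> by linarith+
  qed
  define b where "b = (\<chi> k. 1 - (d $ k + \<epsilon>) / s)"
  let ?B = "U ** diag_mat b ** transpose U"
  let ?M = "\<lambda>n. U ** diag_mat (\<chi> k. b $ k ^ n) ** transpose U"
  have UU: "(\<Sum>k\<in>UNIV. U $ l $ k * U $ m $ k) = (if l = m then 1 else 0)" for l m
  proof -
    have "(U ** transpose U) $ l $ m = mat 1 $ l $ m"
      using U by (simp add: orthogonal_matrix_def)
    then show ?thesis by (simp add: matrix_matrix_mult_def transpose_def mat_def)
  qed
  have B: "?B $ l $ m = (1 - \<epsilon> / s) * (if l = m then 1 else 0) - A $ l $ m / s" for l m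
    unfolding UU[symmetric] conj_diag_mat_nth A sum_distrib_left sum_divide_distrib
      sum_subtractf[symmetric]
    by (intro sum.cong) (simp_all add: b_def field_simps add_divide_distrib diff_divide_distrib)
  have "0 \<le> ?B $ l $ m" for l m
  proof (cases "l = m")
    case True
    then have "?B $ l $ m = (s - (A $ m $ m + \<epsilon>)) / s"
      using s(1) unfolding B by (simp add: diff_divide_distrib add_divide_distrib)
    then show ?thesis using s(1) s(3)[of m] by simp
  next
    case False
    then show ?thesis using s(1) off[of l m] unfolding B by (simp add: divide_nonpos_pos)
  qed
  then have M: "0 \<le> ?M n $ i $ j" for n by (rule conj_diag_mat_power_nonneg[OF U])
  \<comment> \<open>The shift by \<epsilon> gives \<open>b $ k < 1\<close>, inside the interval of
    convergence; unshifted, a zero eigenvalue would sit on its boundary.\<close>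
  have series: "(\<lambda>n. (\<alpha> gchoose n) * (- b $ k) ^ n) sums ((d $ k + \<epsilon>) / s) powr \<alpha>" for k
  proof -
    have "0 < (d $ k + \<epsilon>) / s" "(d $ k + \<epsilon>) / s \<le> 1"
      using s(1) s(2)[of k] d[of k] \<epsilon> by simp_all
    then show ?thesis using gen_binomial_real[of "- b $ k" \<alpha>] by (simp add: b_def)
  qed
  have sums: "(\<lambda>n. \<Sum>k\<in>UNIV. U $ i $ k * U $ j $ k * ((\<alpha> gchoose n) * (- b $ k) ^ n))
      sums (\<Sum>k\<in>UNIV. U $ i $ k * U $ j $ k * ((d $ k + \<epsilon>) / s) powr \<alpha>)"
    by (intro sums_sum sums_mult series)
  have "(\<Sum>k\<in>UNIV. U $ i $ k * U $ j $ k * ((\<alpha> gchoose n) * (- b $ k) ^ n)) \<le> 0" for n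
  proof -
    have "(\<Sum>k\<in>UNIV. U $ i $ k * U $ j $ k * ((\<alpha> gchoose n) * (- b $ k) ^ n))
        = (\<alpha> gchoose n) * (- 1) ^ n * ?M n $ i $ j"
      by (simp add: conj_diag_mat_nth sum_distrib_left power_minus[of "b $ _"] mult_ac)
    also have "\<dots> \<le> 0"
    \<comment> \<open>The constant coefficient is positive, but it multiplies an off-diagonal entry
      of the identity matrix, which is zero.\<close>
    proof (cases n)
      case 0
      then show ?thesis using UU[of i j] ij by (simp add: conj_diag_mat_nth)
    next
      case (Suc m)
      then show ?thesis
        using alternating_gbinomial_nonpos[OF \<alpha>, of m] M[of n] by (simp only: mult_nonpos_nonneg)
    qed
    finally show ?thesis .
  qed
  then have le: "(\<Sum>k\<in>UNIV. U $ i $ k * U $ j $ k * ((d $ k + \<epsilon>) / s) powr \<alpha>) \<le> 0"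
    by (rule sums_le[OF _ sums sums_zero])
  have "(\<Sum>k\<in>UNIV. U $ i $ k * (d $ k + \<epsilon>) powr \<alpha> * U $ j $ k)
      = s powr \<alpha> * (\<Sum>k\<in>UNIV. U $ i $ k * U $ j $ k * ((d $ k + \<epsilon>) / s) powr \<alpha>)"
    unfolding sum_distrib_left using s(1) d \<epsilon>
    by (intro sum.cong refl) (simp add: powr_divide)
  then show ?thesis using le by (simp add: mult_nonneg_nonpos)
qed

lemma powr_offdiag_nonpos:
  fixes U A :: "real^'n^'n"
  assumes U: "orthogonal_matrix U" and A: "A = U ** diag_mat d ** transpose U"
    and d: "\<And>k. 0 \<le> d $ k" and off: "\<And>i j. i \<noteq> j \<Longrightarrow> A $ i $ j \<le> 0"
    and \<alpha>: "0 < \<alpha>" "\<alpha> < 1" and ij: "i \<noteq> j"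
  shows "(U ** diag_mat (\<chi> k. d $ k powr \<alpha>) ** transpose U) $ i $ j \<le> 0"
proof -
  have pos: "eventually (\<lambda>\<epsilon>::real. 0 < \<epsilon>) (at_right 0)"
    by (rule eventually_at_right_less)
  have shift: "((\<lambda>\<epsilon>. d $ k + \<epsilon>) \<longlongrightarrow> d $ k) (at_right 0)" for k
    by (auto intro!: tendsto_eq_intros)
  \<comment> \<open>This includes zero eigenvalues: for a positive exponent, \<open>powr\<close> is
    continuous from the right at base 0, with value 0.\<close>
  have lim: "((\<lambda>\<epsilon>. (d $ k + \<epsilon>) powr \<alpha>) \<longlongrightarrow> d $ k powr \<alpha>) (at_right 0)" for k
    using d[of k] \<alpha> by (intro tendsto_powr2 shift tendsto_const eventually_mono[OF pos]) auto
  have "((\<lambda>\<epsilon>. \<Sum>k\<in>UNIV. U $ i $ k * (d $ k + \<epsilon>) powr \<alpha> * U $ j $ k)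
      \<longlongrightarrow> (\<Sum>k\<in>UNIV. U $ i $ k * d $ k powr \<alpha> * U $ j $ k)) (at_right 0)"
    by (intro tendsto_sum tendsto_mult tendsto_const lim)
  moreover have "eventually (\<lambda>\<epsilon>. (\<Sum>k\<in>UNIV. U $ i $ k * (d $ k + \<epsilon>) powr \<alpha> * U $ j $ k) \<le> 0)
      (at_right 0)"
    using shifted_powr_offdiag_nonpos[OF U A d off \<alpha> _ ij] by (intro eventually_mono[OF pos]) auto
  ultimately show ?thesis
    by (simp add: conj_diag_mat_nth tendsto_upperbound)
qed

text \<open>The \<open>k\<close>-th column of \<open>U\<close> is a unit eigenvector for
  \<open>d $ k\<close>, so the quadratic form takes the value \<open>d $ k\<close> there.\<close>

lemma conj_diag_mat_eigenvalue_nonneg: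
  fixes U A :: "real^'n^'n"
  assumes U: "orthogonal_matrix U" and A: "A = U ** diag_mat d ** transpose U"
    and psd: "\<And>x. 0 \<le> x \<bullet> (A *v x)"
  shows "0 \<le> d $ k"
proof -
  have "A ** U = U ** diag_mat d ** (transpose U ** U)"
    unfolding A by (simp add: matrix_mul_assoc)
  then have AU: "A ** U = U ** diag_mat d" using U by (simp add: orthogonal_matrix_def)
  have "A *v column k U = d $ k *\<^sub>R column k U"
  proof -
    have "(A *v column k U) $ i = (A ** U) $ i $ k" for i
      by (simp add: matrix_matrix_mult_def matrix_vector_mult_def column_def)
    moreover have "(U ** diag_mat d) $ i $ k = (d $ k *\<^sub>R column k U) $ i" for i
      by (simp add: matrix_matrix_mult_def diag_mat_def column_def
          if_distrib[of "\<lambda>x. _ * x"] sum.delta cong: if_cong)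
    ultimately show ?thesis by (simp add: AU vec_eq_iff)
  qed
  moreover have "norm (column k U) = 1"
    using U by (simp add: orthogonal_matrix_orthonormal_columns)
  ultimately show ?thesis
    using psd[of "column k U"] by (simp add: dot_square_norm)
qed

text \<open>Existence of a diagonalization makes the choice in \<open>mat_powr\<close> meaningful:
  the chosen matrix comes from some decomposition, and the sign and symmetry arguments apply to any
  decomposition.\<close>

lemma mat_powr_diagonalization:
  fixes A :: "real^'n^'n"
  assumes "transpose A = A"
  obtains U d where "orthogonal_matrix U" "A = U ** diag_mat d ** transpose U"
    "mat_powr A \<alpha> = U ** diag_mat (\<chi> k. d $ k powr \<alpha>) ** transpose U"
proof -
  obtain U d where "orthogonal_matrix U" "A = U ** diag_mat d ** transpose U"
    using symmetric_matrix_diagonalization[OF assms] .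
  then have "\<exists>P U d. orthogonal_matrix U \<and> A = U ** diag_mat d ** transpose U \<and>
      P = U ** diag_mat (\<chi> i. d $ i powr \<alpha>) ** transpose U"
    by blast
  from someI_ex[OF this] show ?thesis
    using that unfolding mat_powr_def[symmetric] by blast
qed

lemma mat_powr_symmetric:
  assumes "transpose A = A"
  shows "mat_powr A \<alpha> $ i $ j = mat_powr A \<alpha> $ j $ i"
proof -
  obtain U d where "orthogonal_matrix U" "A = U ** diag_mat d ** transpose U"
    and P: "mat_powr A \<alpha> = U ** diag_mat (\<chi> k. d $ k powr \<alpha>) ** transpose U"
    by (rule mat_powr_diagonalization[OF assms])
  show ?thesis by (simp add: P conj_diag_mat_nth mult_ac)
qed

lemma mat_powr_offdiag_nonpos:
  assumes "transpose A = A" "\<And>x. 0 \<le> x \<bullet> (A *v x)" "\<And>i j. i \<noteq> j \<Longrightarrow> A $ i $ j \<le> 0"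
    and "0 < \<alpha>" "\<alpha> < 1" "i \<noteq> j"
  shows "mat_powr A \<alpha> $ i $ j \<le> 0"
proof -
  obtain U d where U: "orthogonal_matrix U" "A = U ** diag_mat d ** transpose U"
    and P: "mat_powr A \<alpha> = U ** diag_mat (\<chi> k. d $ k powr \<alpha>) ** transpose U"
    by (rule mat_powr_diagonalization[OF assms(1)])
  show ?thesis
    unfolding P
    by (rule powr_offdiag_nonpos[OF U conj_diag_mat_eigenvalue_nonneg[OF U assms(2)] assms(3-6)])
qed

section \<open>The Laplacian for the counting measure and the graph
  \<open>r_graph \<alpha> G\<close>\<close>

context
  fixes G :: "'n::finite wgraph"
  assumes G: "is_graph G" and counting: "mkind G = Counting"
begin

lemma weight_sym: "weight G x y = weight G y x"
  using G by (simp add: is_graph_def)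

lemma weight_nonneg: "0 \<le> weight G x y"
  using G by (simp add: is_graph_def)

lemma weight_self: "weight G x x = 0"
  using G by (simp add: is_graph_def)

lemma laplacian_counting: "laplacian G u $ x = (\<Sum>y\<in>UNIV. weight G x y * (u $ x - u $ y))"
  by (simp add: laplacian_def node_measure_def counting)

lemma linear_laplacian: "linear (laplacian G)"
proof (rule linearI; unfold vec_eq_iff; intro allI)
  fix u v x
  show "laplacian G (u + v) $ x = (laplacian G u + laplacian G v) $ x"
    unfolding laplacian_counting vector_add_component sum.distrib[symmetric]
    by (intro sum.cong refl) (simp add: algebra_simps)
next
  fix c u x
  show "laplacian G (c *\<^sub>R u) $ x = (c *\<^sub>R laplacian G u) $ x"
    unfolding laplacian_counting vector_scaleR_component real_scaleR_def sum_distrib_left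
    by (intro sum.cong refl) (simp add: algebra_simps)
qed

lemma matrix_laplacian_offdiag:
  assumes "i \<noteq> j"
  shows "matrix (laplacian G) $ i $ j = - weight G i j"
proof -
  have "matrix (laplacian G) $ i $ j = (\<Sum>y\<in>UNIV. if y = j then - weight G i j else 0)"
    unfolding matrix_def vec_lambda_beta laplacian_counting
    using assms by (intro sum.cong refl) (simp add: axis_def)
  then show ?thesis by simp
qed

lemma transpose_matrix_laplacian: "transpose (matrix (laplacian G)) = matrix (laplacian G)"
  unfolding vec_eq_iff
proof (intro allI)
  fix i j
  show "transpose (matrix (laplacian G)) $ i $ j = matrix (laplacian G) $ i $ j"
    using weight_sym[of i j] by (cases "i = j") (simp_all add: transpose_def matrix_laplacian_offdiag)
qed

text \<open>Exchanging the two nodes in the double sum and averaging turns the form into half the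
  sum of \<open>weight G x y * (u $ x - u $ y)\<^sup>2\<close>, the Dirichlet energy.\<close>

lemma laplacian_psd: "0 \<le> u \<bullet> laplacian G u"
proof -
  let ?S = "\<Sum>x\<in>UNIV. \<Sum>y\<in>UNIV. weight G x y * (u $ x * (u $ x - u $ y))"
  have S: "u \<bullet> laplacian G u = ?S"
    by (simp add: inner_vec_def laplacian_counting sum_distrib_left mult_ac)
  have "?S = (\<Sum>x\<in>UNIV. \<Sum>y\<in>UNIV. weight G x y * (u $ y * (u $ y - u $ x)))"
    by (subst sum.swap, subst weight_sym) (rule refl)
  then have "2 * ?S = (\<Sum>x\<in>UNIV. \<Sum>y\<in>UNIV. weight G x y * (u $ x * (u $ x - u $ y)))
      + (\<Sum>x\<in>UNIV. \<Sum>y\<in>UNIV. weight G x y * (u $ y * (u $ y - u $ x)))"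
    by simp
  also have "\<dots> = (\<Sum>x\<in>UNIV. \<Sum>y\<in>UNIV. weight G x y * (u $ x - u $ y)\<^sup>2)"
    unfolding sum.distrib[symmetric]
    by (intro sum.cong refl) (simp add: power2_eq_square algebra_simps)
  also have "\<dots> \<ge> 0" by (intro sum_nonneg mult_nonneg_nonneg weight_nonneg zero_le_power2)
  finally show ?thesis by (simp add: S)
qed

lemma r_graph_extends: "adj G x y \<Longrightarrow> weight (r_graph \<alpha> G) x y = weight G x y"
  by (auto simp: r_graph_def adj_def weight_self)

text \<open>The weights off the edges of \<open>G\<close> are negated off-diagonal entries of the
  fractional power, hence nonnegative. Connectedness is inherited because every edge of
  \<open>G\<close> is kept.\<close>

lemma is_graph_r_graph:
  assumes "0 < \<alpha>" "\<alpha> < 1"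
  shows "is_graph (r_graph \<alpha> G)"
proof -
  let ?L = "matrix (laplacian G)"
  have "0 \<le> x \<bullet> (?L *v x)" for x
    using laplacian_psd by (simp add: matrix_works linear_laplacian)
  then have "mat_powr ?L \<alpha> $ x $ y \<le> 0" if "x \<noteq> y" for x y
    using that assms
    by (intro mat_powr_offdiag_nonpos transpose_matrix_laplacian)
      (auto simp: matrix_laplacian_offdiag weight_nonneg)
  then have "0 \<le> weight (r_graph \<alpha> G) x y" for x y
    by (simp add: r_graph_def weight_nonneg)
  moreover have "weight (r_graph \<alpha> G) x y = weight (r_graph \<alpha> G) y x" for x y
    using mat_powr_symmetric[OF transpose_matrix_laplacian] weight_sym
    by (auto simp: r_graph_def adj_def)
  moreover have "(adj (r_graph \<alpha> G))\<^sup>*\<^sup>* x y" for x y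
  proof -
    have "adj G \<le> adj (r_graph \<alpha> G)"
      by (auto simp: adj_def r_graph_extends[unfolded adj_def])
    then show ?thesis
      using G rtranclp_mono[of "adj G"] unfolding is_graph_def by blast
  qed
  ultimately show ?thesis
    using G by (auto simp: is_graph_def node_measure_def r_graph_def)
qed

end

section \<open>Normalizations and induced graphs\<close>

text \<open>Makes the degree measure admissible: a path from \<open>x\<close> to a different node
  starts with an edge at \<open>x\<close>.\<close>

lemma wdeg_pos:
  fixes G :: "'n::finite wgraph"
  assumes G: "is_graph G"
  shows "0 < wdeg G x"
proof -
  have "CARD('n) \<ge> 2" using G by (simp add: is_graph_def)
  then obtain y where "y \<noteq> x"
    by (metis UNIV_I card_2_iff' ex_card subset_UNIV)
  moreover have "(adj G)\<^sup>*\<^sup>* x y" using G by (simp add: is_graph_def)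
  ultimately obtain z where "adj G x z" by (metis converse_rtranclpE)
  moreover have "weight G x z \<le> wdeg G x"
    unfolding wdeg_def using G by (intro member_le_sum) (auto simp: is_graph_def)
  ultimately show ?thesis by (simp add: adj_def)
qed

lemma is_graph_normalization:
  assumes "is_graph G"
  shows "is_graph (normalization G)"
proof -
  have "adj (normalization G) = adj G" by (simp add: fun_eq_iff adj_def normalization_def)
  moreover have "node_measure (normalization G) x = wdeg G x" for x
    by (simp add: node_measure_def normalization_def wdeg_def)
  ultimately show ?thesis
    using assms wdeg_pos[OF assms] by (simp add: is_graph_def normalization_def)
qed

text \<open>Off the edges the weights of \<open>G\<close> are nonnegative and not positive, hence
  zero, so restricting \<open>G'\<close> to the edges of \<open>G\<close> recovers
  \<open>G\<close>.\<close>

lemma id_graph_eqI: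
  assumes "is_graph G" "mkind G' = mkind G" "\<And>x y. adj G x y \<Longrightarrow> weight G' x y = weight G x y"
  shows "id_graph G G' = G"
proof -
  have "(if adj G x y then weight G' x y else 0) = weight G x y" for x y
    using assms(1,3) by (simp add: adj_def is_graph_def not_less order_antisym)
  then show ?thesis using assms(2) by (cases G) (simp add: id_graph_def)
qed

theorem proposition5p1:
  fixes G :: "'n::finite wgraph" and \<alpha> :: real
  assumes "is_graph G" and "mkind G = Counting"
    and "0 < \<alpha>" and "\<alpha> < 1"
  shows "embeds_id (normalization G) (normalization (r_graph \<alpha> G)) \<and>
         compatible_with (r_graph \<alpha> G) G"
proof -
  let ?R = "r_graph \<alpha> G"
  have R: "is_graph ?R" using assms by (rule is_graph_r_graph)
  have w: "weight ?R x y = weight G x y" if "adj G x y" for x y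
    using r_graph_extends[OF assms(1,2) that] .
  have "id_graph G ?R = G"
    using assms(1,2) w by (intro id_graph_eqI) (auto simp: r_graph_def)
  \<comment> \<open>Both normalizations carry the tag \<open>Degree\<close>, so the measure of the
    induced graph is the degree over the edges of \<open>G\<close> alone, not the degree in
    \<open>?R\<close>.\<close>
  moreover have "id_graph (normalization G) (normalization ?R) = normalization G"
    using assms(1) w
    by (intro id_graph_eqI is_graph_normalization) (auto simp: normalization_def adj_def)
  moreover have "id_setting G ?R"
    using assms(1) R w by (auto simp: id_setting_def adj_def)
  moreover have "id_setting (normalization G) (normalization ?R)"
    using assms(1) R w
    by (auto simp: id_setting_def is_graph_normalization) (simp add: adj_def normalization_def)
  ultimately show ?thesis
    by (simp add: embeds_id_def compatible_with_def)
qed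

end
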